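(* Let $\mu$ be a positive rational number. For every positive integer $n$, the fractional differential equation (on $x>0$) $$\left({}^CD_x^\mu\right)^2y(x)-2x^\mu\,{}^CD_x^\mu y(x)+\frac{2\Gamma(\mu)}{B(1+\mu(n-1),\mu)}\,y(x)=0$$ has a solution which is a polynomial in $x^\mu$ of degree $n$, $$y_{H,m_\mu}(x)=\sum_{\nu=0}^na_\nu x^{\mu\nu},$$ where: (1) If $n$ is even, $a_0\neq0$ is arbitrary, $a_{2k-1}=0$ for $1\le k\le n/2$, $a_2=-\frac{2\Gamma(\mu)}{B(1+\mu(n-1),\mu)\Gamma(1+2\mu)}a_0$, and for $k\ge2$ (with $2k\le n$) $$a_{2k}=-\frac{2\Gamma(\mu)a_0}{B(1+\mu(n-1),\mu)\Gamma(1+2\mu)}\prod_{j=1}^{k-1}\frac{2\Gamma(\mu)B(1+2j\mu,2\mu)\left[B(1+\mu(n-1),\mu)-B(1+\mu(2j-1),\mu)\right]}{\Gamma(2\mu)B(1+\mu(n-1),\mu)B(1+\mu(2j-1),\mu)}.$$ (2) If $n$ is odd, $a_1\neq0$ is arbitrary, $a_{2k}=0$ for $0\le k\le\lfloor n/2\rfloor$, and for $k\ge1$ (with $2k+1\le n$) $$a_{2k+1}=a_1\prod_{j=0}^{k-1}\frac{2\Gamma(\mu)B(1+(2j+1)\mu,2\mu)\left[B(1+\mu(n-1),\mu)-B(1+2j\mu,\mu)\right]}{\Gamma(2\mu)B(1+\mu(n-1),\mu)B(1+2j\mu,\mu)}.$$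
   Context: $\Gamma$ is the Gamma function and $B(\cdot,\cdot)$ the beta function, $B(a,b)=\Gamma(a)\Gamma(b)/\Gamma(a+b)$. ${}^CD_x^\mu$ is the Caputo fractional derivative with base point $0$: for $x>0$, ${}^CD_x^\mu f(x)=\frac{1}{\Gamma(N-\mu)}\int_0^x\frac{f^{(N)}(\tau)}{(x-\tau)^{\mu+1-N}}\,d\tau$ if $N-1<\mu<N\in\mathbb{N}$, and ${}^CD_x^Nf=\frac{d^N}{dx^N}f$ if $\mu=N\in\mathbb{N}$. $({}^CD_x^\mu)^2$ means ${}^CD_x^\mu$ applied twice. *)

theory Defs
  imports "HOL-Analysis.Analysis" "HOL-Computational_Algebra.Polynomial"
begin

text \<open>
  Caputo derivative of order \<open>\<mu> > 0\<close> with base point \<open>0\<close>. Only its values at \<open>x > 0\<close> are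
  meaningful; these depend only on \<open>f\<close> restricted to the positive half-line. For
  \<open>\<mu> \<notin> \<nat>\<close>, the integer \<open>N = \<lceil>\<mu>\<rceil>\<close> is the one with \<open>N - 1 < \<mu> < N\<close>.
\<close>

definition caputo_deriv :: "real \<Rightarrow> (real \<Rightarrow> real) \<Rightarrow> real \<Rightarrow> real" where
  "caputo_deriv \<mu> f x =
     (let N = nat \<lceil>\<mu>\<rceil> in
      if \<mu> \<in> \<nat> then (deriv ^^ N) f x
      else 1 / Gamma (real N - \<mu>) *
           integral {0<..<x} (\<lambda>\<tau>. (deriv ^^ N) f \<tau> / (x - \<tau>) powr (\<mu> + 1 - real N)))"

text \<open>
  Since \<open>deriv\<close> and \<open>integral\<close> are total, well-definedness of the Caputo derivative on the
  positive half-line is a separate condition: \<open>f\<close> is \<open>N\<close> times differentiable there and, for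
  fractional order, the defining integral converges absolutely.
\<close>

definition caputo_differentiable :: "real \<Rightarrow> (real \<Rightarrow> real) \<Rightarrow> bool" where
  "caputo_differentiable \<mu> f \<longleftrightarrow>
     (let N = nat \<lceil>\<mu>\<rceil> in
      (\<forall>k<N. \<forall>x>0. (deriv ^^ k) f field_differentiable (at x)) \<and>
      (\<mu> \<notin> \<nat> \<longrightarrow>
        (\<forall>x>0. (\<lambda>\<tau>. (deriv ^^ N) f \<tau> / (x - \<tau>) powr (\<mu> + 1 - real N))
                  absolutely_integrable_on {0<..<x})))"

definition fractional_Hermite_solution :: "real \<Rightarrow> nat \<Rightarrow> (real \<Rightarrow> real) \<Rightarrow> bool" where
  "fractional_Hermite_solution \<mu> n y \<longleftrightarrow>
     caputo_differentiable \<mu> y \<and>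
     caputo_differentiable \<mu> (caputo_deriv \<mu> y) \<and>
     (\<forall>x>0. (caputo_deriv \<mu> ^^ 2) y x - 2 * x powr \<mu> * caputo_deriv \<mu> y x
              + 2 * Gamma \<mu> / Beta (1 + \<mu> * (real n - 1)) \<mu> * y x = 0)"

end

theory Submission
  imports Defs
begin

text \<open>
  On \<open>x > 0\<close> the Caputo derivative maps \<open>x powr (\<mu> * \<nu>)\<close> to \<open>h \<nu> * x powr (\<mu> * (\<nu> - 1))\<close> with
  \<open>h \<nu> = Gamma (1 + \<mu> * \<nu>) / Gamma (1 + \<mu> * (\<nu> - 1)) = Gamma \<mu> / Beta (1 + \<mu> * (\<nu> - 1)) \<mu>\<close> and
  \<open>h 0 = 0\<close>, so the equation becomes the two-step recurrence
  \<open>h (\<nu> + 2) * h (\<nu> + 1) * a (\<nu> + 2) = 2 * (h \<nu> - h n) * a \<nu>\<close>. It breaks off at \<open>\<nu> = n\<close> and not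
  earlier, because \<open>h\<close> is strictly increasing: the logarithmic derivative of
  \<open>Gamma (x + \<mu>) / Gamma x\<close> is \<open>Digamma (x + \<mu>) - Digamma x > 0\<close>.
\<close>

text \<open>
  The value at \<open>0\<close> is separate because constants have derivative \<open>0\<close>, while the quotient of
  Gamma values is nonzero there for non-integer \<open>\<mu>\<close>.
\<close>

definition caputo_coeff :: "real \<Rightarrow> nat \<Rightarrow> real" where
  "caputo_coeff \<mu> \<nu> =
     (if \<nu> = 0 then 0 else Gamma (1 + \<mu> * real \<nu>) / Gamma (1 + \<mu> * (real \<nu> - 1)))"

section \<open>The multipliers \<open>caputo_coeff\<close>: Beta form, positivity,
  monotonicity\<close>

lemma Beta_pos_real:
  fixes a b :: real
  assumes "a > 0" "b > 0"
  shows "Beta a b > 0"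
  using assms by (simp add: Beta_def)

text \<open>Identifies the constant of the equation as \<open>2 * caputo_coeff \<mu> n\<close> and
  brings the Beta values into the closed formulas.\<close>

lemma caputo_coeff_Beta:
  assumes "\<mu> > 0" "\<nu> > 0"
  shows "caputo_coeff \<mu> \<nu> = Gamma \<mu> / Beta (1 + \<mu> * (real \<nu> - 1)) \<mu>"
proof -
  have "0 \<le> \<mu> * (real \<nu> - 1)"
    using assms by simp
  hence "Gamma (1 + \<mu> * (real \<nu> - 1)) > 0"
    by (intro Gamma_real_pos) linarith
  moreover have "Gamma \<mu> > 0"
    using assms by simp
  moreover have "Gamma (1 + \<mu> * (real \<nu> - 1) + \<mu>) = Gamma (1 + \<mu> * real \<nu>)"
    by (simp add: algebra_simps)
  ultimately show ?thesis
    using \<open>\<nu> > 0\<close> by (simp add: caputo_coeff_def Beta_def)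
qed

lemma caputo_coeff_pos:
  assumes "\<mu> > 0" "\<nu> > 0"
  shows "caputo_coeff \<mu> \<nu> > 0"
proof -
  have "0 \<le> \<mu> * (real \<nu> - 1)"
    using assms by simp
  with assms show ?thesis
    by (auto simp: caputo_coeff_def intro!: divide_pos_pos Gamma_real_pos add_pos_nonneg)
qed

lemma caputo_coeff_less_Suc:
  assumes "\<mu> > 0"
  shows "caputo_coeff \<mu> \<nu> < caputo_coeff \<mu> (Suc \<nu>)"
proof (cases "\<nu> = 0")
  \<comment> \<open>At \<open>\<nu> = 0\<close> the multiplier is the prescribed 0 and not a Gamma
    quotient, so the comparison rests on positivity alone.\<close>
  case True
  thus ?thesis
    using caputo_coeff_pos[OF assms, of "Suc \<nu>"] by (simp add: caputo_coeff_def)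
next
  case False
  \<comment> \<open>The logarithm of the Gamma quotient: its values at
    \<open>1 + \<mu> * (\<nu> - 1)\<close> and \<open>1 + \<mu> * \<nu>\<close> are the logarithms
    of the two multipliers. Both points are positive because \<open>\<nu>\<close> is at least
    1.\<close>
  define q :: "real \<Rightarrow> real" where "q = (\<lambda>x. ln_Gamma (x + \<mu>) - ln_Gamma x)"
  have pos: "1 + \<mu> * (real \<nu> - 1) > 0"
    using assms False by (intro add_pos_nonneg) auto
  have "\<exists>y. (q has_real_derivative y) (at x) \<and> 0 < y" if "x \<ge> 1 + \<mu> * (real \<nu> - 1)" for x
  proof -
    have "x > 0"
      using that pos by linarith
    hence "(q has_real_derivative Digamma (x + \<mu>) - Digamma x) (at x)"
      unfolding q_def using assms by (auto intro!: derivative_eq_intros)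
    moreover have "Digamma x < Digamma (x + \<mu>)"
      using \<open>x > 0\<close> assms by (intro Digamma_real_strict_mono) auto
    ultimately show ?thesis
      by (intro exI[of _ "Digamma (x + \<mu>) - Digamma x"]) simp
  qed
  moreover have "1 + \<mu> * (real \<nu> - 1) < 1 + \<mu> * real \<nu>"
    using assms by (simp add: algebra_simps)
  ultimately have less: "q (1 + \<mu> * (real \<nu> - 1)) < q (1 + \<mu> * real \<nu>)"
    by (intro DERIV_pos_imp_increasing[of _ _ q]) blast+
  have q: "exp (q x) = Gamma (x + \<mu>) / Gamma x" if "x > 0" for x
    using that assms by (simp only: q_def exp_diff Gamma_real_pos_exp add_pos_pos)
  have "1 + \<mu> * real \<nu> > 0"
    using assms by (intro add_pos_nonneg) auto
  have "caputo_coeff \<mu> \<nu> = exp (q (1 + \<mu> * (real \<nu> - 1)))"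
    using False by (subst q[OF pos]) (simp add: caputo_coeff_def algebra_simps)
  also have "\<dots> < exp (q (1 + \<mu> * real \<nu>))"
    using less by simp
  also have "\<dots> = caputo_coeff \<mu> (Suc \<nu>)"
    by (subst q[OF \<open>1 + \<mu> * real \<nu> > 0\<close>]) (simp add: caputo_coeff_def algebra_simps)
  finally show ?thesis .
qed

lemma caputo_coeff_less:
  assumes "\<mu> > 0" "\<kappa> < \<nu>"
  shows "caputo_coeff \<mu> \<kappa> < caputo_coeff \<mu> \<nu>"
  using caputo_coeff_less_Suc[OF assms(1)] assms(2) by (rule lift_Suc_mono_less)

text \<open>The middle factor \<open>Gamma (1 + \<mu> * (\<nu> + 1))\<close> cancels. Both indices
  are positive, so the special value at 0 does not enter, even for \<open>\<nu> = 0\<close>.\<close>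

lemma caputo_coeff_mult_Suc:
  assumes "\<mu> > 0"
  shows "caputo_coeff \<mu> (Suc (Suc \<nu>)) * caputo_coeff \<mu> (Suc \<nu>) =
         Gamma (1 + (real \<nu> + 2) * \<mu>) / Gamma (1 + real \<nu> * \<mu>)"
proof -
  have "Gamma (1 + \<mu> * real (Suc \<nu>)) > 0"
    using assms by (intro Gamma_real_pos add_pos_nonneg) auto
  thus ?thesis
    by (simp add: caputo_coeff_def algebra_simps)
qed

section \<open>Higher derivatives of sums of real powers\<close>

text \<open>Only the values at positive points are prescribed, so that functions known only there,
  such as a Caputo derivative, are covered. The half-line is open, hence agreement on it suffices
  for differentiation.\<close>

lemma higher_deriv_powr_sum:
  fixes f :: "real \<Rightarrow> real"
  assumes "\<And>x. x > 0 \<Longrightarrow> f x = (\<Sum>i\<in>A. c i * x powr e i)" and "x > 0"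
  shows "(deriv ^^ k) f x = (\<Sum>i\<in>A. c i * (\<Prod>j<k. e i - real j) * x powr (e i - real k))" (is ?val)
    and "((deriv ^^ k) f has_real_derivative
            (\<Sum>i\<in>A. c i * (\<Prod>j<Suc k. e i - real j) * x powr (e i - real (Suc k)))) (at x)" (is ?deriv)
proof -
  \<comment> \<open>The claims need each other: the derivative at order \<open>k\<close>, known at
    every positive point, gives the value at order \<open>k + 1\<close> on a neighbourhood, and that
    value can be differentiated again.\<close>
  have main: "?val \<and> ?deriv" using \<open>x > 0\<close>
  proof (induction k arbitrary: x)
    case (0 x)
    have ev: "\<forall>\<^sub>F t in nhds x. f t = (\<Sum>i\<in>A. c i * t powr e i)"
      using eventually_nhds_in_open[of "{0<..}" x] 0 by (auto elim!: eventually_mono simp: assms(1))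
    have "((\<lambda>t. \<Sum>i\<in>A. c i * t powr e i) has_real_derivative
            (\<Sum>i\<in>A. c i * e i * x powr (e i - 1))) (at x)"
      using 0 by (auto intro!: derivative_eq_intros sum.cong)
    with ev 0 show ?case
      by (simp add: assms(1) DERIV_cong_ev[OF refl ev refl])
  next
    case (Suc k x)
    let ?g = "\<lambda>x. \<Sum>i\<in>A. c i * (\<Prod>j<Suc k. e i - real j) * x powr (e i - real (Suc k))"
    have val: "(deriv ^^ Suc k) f t = ?g t" if "t > 0" for t
      using Suc.IH[OF that] by (auto dest: DERIV_imp_deriv)
    have ev: "\<forall>\<^sub>F t in nhds x. (deriv ^^ Suc k) f t = ?g t"
      using eventually_nhds_in_open[of "{0<..}" x] Suc.prems
      by (auto elim!: eventually_mono simp del: funpow.simps simp: val)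
    have "((\<lambda>t. c i * (\<Prod>j<Suc k. e i - real j) * t powr (e i - real (Suc k))) has_real_derivative
            c i * (\<Prod>j<Suc (Suc k). e i - real j) * x powr (e i - real (Suc (Suc k)))) (at x)" for i
      using DERIV_cmult[OF has_real_derivative_powr[OF Suc.prems],
          of "c i * (\<Prod>j<Suc k. e i - real j)" "e i - real (Suc k)"]
      by (simp add: mult.assoc diff_diff_eq add.commute)
    hence "(?g has_real_derivative
            (\<Sum>i\<in>A. c i * (\<Prod>j<Suc (Suc k). e i - real j) * x powr (e i - real (Suc (Suc k))))) (at x)"
      by (rule DERIV_sum)
    with val[OF Suc.prems] show ?case
      by (simp only: DERIV_cong_ev[OF refl ev refl])
  qed
  show ?val ?deriv using main by blast+
qed

text \<open>Read backwards, the product is the rising factorial of \<open>b + 1 - k\<close>, hence a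
  Gamma quotient; the hypothesis avoids the poles.\<close>

lemma falling_prod_Gamma:
  fixes b :: real
  assumes "b + 1 - real k > 0"
  shows "(\<Prod>j<k. b - real j) = Gamma (b + 1) / Gamma (b + 1 - real k)"
proof -
  have "b + 1 - real k \<notin> \<int>\<^sub>\<le>\<^sub>0"
    using assms by (auto elim!: nonpos_Ints_cases)
  hence "pochhammer (b - real k + 1) k = Gamma (b + 1) / Gamma (b + 1 - real k)"
    using pochhammer_Gamma[of "b + 1 - real k" k] by (simp add: algebra_simps)
  \<comment> \<open>Both sides are \<open>fact k\<close> times the generalized binomial coefficient
    \<open>b gchoose k\<close>.\<close>
  moreover have "pochhammer (b - real k + 1) k = (\<Prod>j<k. b - real j)"
    using gbinomial_pochhammer'[of b k] gbinomial_prod_rev[of b k]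
    by (simp add: atLeast0LessThan)
  ultimately show ?thesis by simp
qed

section \<open>Caputo derivatives of powers via the Beta integral\<close>

lemma has_integral_Beta_scaled:
  fixes a b x :: real
  assumes "a > 0" "b > 0" "x > 0"
  shows "((\<lambda>t. t powr (a - 1) * (x - t) powr (b - 1)) has_integral
            Beta a b * x powr (a + b - 1)) {0<..<x}"
proof -
  have "((\<lambda>t. t powr (a - 1) * (1 - t) powr (b - 1)) has_integral Beta a b) (cbox 0 1)"
    using has_integral_Beta_real[OF assms(1,2)] by simp
  from has_integral_affinity'[OF this, of "1 / x" 0]
  have "((\<lambda>t. (t / x) powr (a - 1) * (1 - t / x) powr (b - 1)) has_integral x * Beta a b) {0..x}"
    using assms by (simp add: field_simps)
  \<comment> \<open>This factor is \<open>x powr (a - 1) * x powr (b - 1)\<close>. It clears the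
    denominators left by the substitution \<open>t / x\<close>, and with the Jacobian
    \<open>x\<close> it yields the exponent \<open>a + b - 1\<close>.\<close>
  from has_integral_mult_right[OF this, of "x powr (a + b - 2)"]
  have "((\<lambda>t. x powr (a + b - 2) * ((t / x) powr (a - 1) * (1 - t / x) powr (b - 1)))
          has_integral x powr (a + b - 2) * (x * Beta a b)) {0<..<x}"
    by (simp add: has_integral_Icc_iff_Ioo)
  moreover have "x powr (a + b - 2) * ((t / x) powr (a - 1) * (1 - t / x) powr (b - 1)) =
      t powr (a - 1) * (x - t) powr (b - 1)" if "t \<in> {0<..<x}" for t
  proof -
    have "1 - t / x = (x - t) / x"
      using assms by (simp add: field_simps)
    moreover have "x powr (a + b - 2) = x powr (a - 1) * x powr (b - 1)"
      by (simp flip: powr_add)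
    ultimately show ?thesis
      using that by (simp add: powr_divide)
  qed
  moreover have "x powr (a + b - 2) * (x * Beta a b) = Beta a b * x powr (a + b - 1)"
    using assms powr_add[of x "a + b - 2" 1] by simp
  ultimately show ?thesis
    by (metis (no_types, lifting) has_integral_cong)
qed

text \<open>The integral is a Beta value whose factor \<open>Gamma (\<mu> * \<nu> + 1 - N)\<close>
  cancels against the falling product. Convergence at 0 holds for \<open>\<nu> \<ge> 1\<close> since
  \<open>\<mu> * \<nu> \<ge> \<mu> > N - 1\<close>; for \<open>\<nu> = 0\<close> the integrand is
  zero.\<close>

lemma caputo_integral_monomial:
  fixes \<mu> x :: real and \<nu> :: nat
  defines "N \<equiv> nat \<lceil>\<mu>\<rceil>"
  assumes "\<mu> > 0" "\<mu> \<notin> \<nat>" "x > 0"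
  defines "g \<equiv> (\<lambda>\<tau>. (\<Prod>j<N. \<mu> * real \<nu> - real j) * \<tau> powr (\<mu> * real \<nu> - real N)
                    / (x - \<tau>) powr (\<mu> + 1 - real N))"
  shows "(g has_integral Gamma (real N - \<mu>) * caputo_coeff \<mu> \<nu> * x powr (\<mu> * real \<nu> - \<mu>)) {0<..<x}"
    and "g absolutely_integrable_on {0<..<x}"
proof -
  have N: "real N > \<mu>" "real N < \<mu> + 1"
  proof -
    have "real N = of_int \<lceil>\<mu>\<rceil>"
      using assms(2) by (simp add: N_def)
    moreover have "real N \<noteq> \<mu>"
      using assms(3) by (metis of_nat_in_Nats)
    ultimately show "real N > \<mu>" "real N < \<mu> + 1"
      by linarith+
  qed
  have "(g has_integral Gamma (real N - \<mu>) * caputo_coeff \<mu> \<nu> * x powr (\<mu> * real \<nu> - \<mu>)) {0<..<x} \<and>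
        g absolutely_integrable_on {0<..<x}"
  proof (cases "\<nu> = 0")
    case True
    have "N > 0"
      using N assms(2) by linarith
    \<comment> \<open>The factor with \<open>j = 0\<close> vanishes.\<close>
    hence "(\<Prod>j<N. \<mu> * real \<nu> - real j) = 0"
      using True by auto
    hence "g = (\<lambda>\<tau>. 0)"
      by (simp only: g_def mult_zero_left div_0)
    thus ?thesis
      using True by (simp add: caputo_coeff_def)
  next
    case False
    define a where "a = \<mu> * real \<nu> + 1 - real N"
    define P where "P = (\<Prod>j<N. \<mu> * real \<nu> - real j)"
    have "\<mu> \<le> \<mu> * real \<nu>"
      using assms(2) False by simp
    hence a: "a > 0"
      using N by (simp add: a_def)
    have P: "P = Gamma (\<mu> * real \<nu> + 1) / Gamma a"
      unfolding P_def a_def by (rule falling_prod_Gamma) (use a in \<open>simp add: a_def\<close>)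
    \<comment> \<open>This makes the integrand nonnegative, so that integrability already gives
      absolute integrability.\<close>
    have "P > 0"
      unfolding P using a assms(2) by (intro divide_pos_pos Gamma_real_pos add_nonneg_pos) auto
    have g: "g \<tau> = P * (\<tau> powr (a - 1) * (x - \<tau>) powr ((real N - \<mu>) - 1))" for \<tau>
      using powr_minus_divide[of "x - \<tau>" "\<mu> + 1 - real N"]
      by (simp add: g_def P_def a_def diff_diff_eq add.commute)
    have "(g has_integral P * (Beta a (real N - \<mu>) * x powr (a + (real N - \<mu>) - 1))) {0<..<x}"
      unfolding g using N assms(4) a
      by (intro has_integral_mult_right has_integral_Beta_scaled) auto
    moreover have "P * (Beta a (real N - \<mu>) * x powr (a + (real N - \<mu>) - 1)) =
        Gamma (real N - \<mu>) * caputo_coeff \<mu> \<nu> * x powr (\<mu> * real \<nu> - \<mu>)"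
    proof -
      have "Gamma a > 0"
        using a by simp
      moreover have "Beta a (real N - \<mu>) = Gamma a * Gamma (real N - \<mu>) / Gamma (1 + \<mu> * (real \<nu> - 1))"
        by (simp add: Beta_def a_def algebra_simps)
      moreover have "x powr (a + (real N - \<mu>) - 1) = x powr (\<mu> * real \<nu> - \<mu>)"
        by (simp add: a_def)
      ultimately show ?thesis
        using False by (simp add: P caputo_coeff_def add.commute)
    qed
    moreover have "g \<tau> \<ge> 0" for \<tau>
      using \<open>P > 0\<close> by (simp add: g)
    ultimately show ?thesis
      by (auto intro!: nonnegative_absolutely_integrable_1)
  qed
  thus "(g has_integral Gamma (real N - \<mu>) * caputo_coeff \<mu> \<nu> * x powr (\<mu> * real \<nu> - \<mu>)) {0<..<x}"
    "g absolutely_integrable_on {0<..<x}"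
    by blast+
qed

text \<open>For integer order the ordinary \<open>N\<close>-th derivative produces the same
  multiplier, so both branches of the Caputo derivative follow one formula. At
  \<open>\<nu> = 0\<close> the factor \<open>j = 0\<close> matches the prescribed value 0.\<close>

lemma falling_prod_caputo_coeff:
  fixes N \<nu> :: nat
  assumes "N > 0"
  shows "(\<Prod>j<N. real N * real \<nu> - real j) = caputo_coeff (real N) \<nu>"
proof (cases "\<nu> = 0")
  case True
  thus ?thesis
    using assms by (auto simp: caputo_coeff_def)
next
  case False
  hence "real N \<le> real N * real \<nu>"
    using assms by simp
  thus ?thesis
    using False falling_prod_Gamma[of "real N * real \<nu>" N]
    by (simp add: caputo_coeff_def algebra_simps)
qed

text \<open>Linearity reduces this to single powers. Since \<open>f\<close> is prescribed only on
  the positive half-line, the rule can be applied again to its own result.\<close>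

lemma caputo_powr_sum:
  fixes f :: "real \<Rightarrow> real"
  assumes "\<mu> > 0" and f: "\<And>x. x > 0 \<Longrightarrow> f x = (\<Sum>\<nu>\<le>n. c \<nu> * x powr (\<mu> * real \<nu>))"
  shows "caputo_differentiable \<mu> f"
    and "x > 0 \<Longrightarrow> caputo_deriv \<mu> f x =
           (\<Sum>\<nu>\<le>n. c \<nu> * caputo_coeff \<mu> \<nu> * x powr (\<mu> * real \<nu> - \<mu>))"
proof -
  define N where "N = nat \<lceil>\<mu>\<rceil>"
  define g where "g = (\<lambda>\<nu> x \<tau>. (\<Prod>j<N. \<mu> * real \<nu> - real j) * \<tau> powr (\<mu> * real \<nu> - real N)
                    / (x - \<tau>) powr (\<mu> + 1 - real N))"
  note deriv_f = higher_deriv_powr_sum[where e = "\<lambda>\<nu>. \<mu> * real \<nu>", OF f]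
  have integrand: "(deriv ^^ N) f \<tau> / (x - \<tau>) powr (\<mu> + 1 - real N) = (\<Sum>\<nu>\<le>n. c \<nu> * g \<nu> x \<tau>)"
    if "\<tau> \<in> {0<..<x}" for x \<tau>
    using that by (simp add: deriv_f(1) g_def sum_divide_distrib mult.assoc)
  have g: "(g \<nu> x has_integral Gamma (real N - \<mu>) * caputo_coeff \<mu> \<nu> * x powr (\<mu> * real \<nu> - \<mu>)) {0<..<x}"
    "g \<nu> x absolutely_integrable_on {0<..<x}" if "\<mu> \<notin> \<nat>" "x > 0" for \<nu> x
    using caputo_integral_monomial[of \<mu> x \<nu>] that assms(1) by (simp_all add: g_def N_def)
  have "(\<lambda>\<tau>. (deriv ^^ N) f \<tau> / (x - \<tau>) powr (\<mu> + 1 - real N)) absolutely_integrable_on {0<..<x}"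
    if "\<mu> \<notin> \<nat>" "x > 0" for x
  proof -
    have "(\<lambda>\<tau>. \<Sum>\<nu>\<le>n. c \<nu> * g \<nu> x \<tau>) absolutely_integrable_on {0<..<x}"
      using g(2)[OF that] by (intro absolutely_integrable_sum set_integrable_mult_right) auto
    \<comment> \<open>With the empty exceptional set, the spike rule acts as a congruence on the
      open interval.\<close>
    thus ?thesis
      by (rule absolutely_integrable_spike[OF _ negligible_empty]) (simp add: integrand)
  qed
  moreover have "(deriv ^^ k) f field_differentiable (at x)" if "x > 0" for k x
    using deriv_f(2)[OF _ that] field_differentiable_def by blast
  ultimately show "caputo_differentiable \<mu> f"
    by (auto simp: caputo_differentiable_def N_def Let_def)
  show "caputo_deriv \<mu> f x = (\<Sum>\<nu>\<le>n. c \<nu> * caputo_coeff \<mu> \<nu> * x powr (\<mu> * real \<nu> - \<mu>))" if "x > 0"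
  proof (cases "\<mu> \<in> \<nat>")
    case True
    hence N: "\<mu> = real N"
      by (auto simp: N_def elim!: Nats_cases)
    hence "N > 0"
      using assms(1) by simp
    with True that show ?thesis
      by (simp add: caputo_deriv_def Let_def deriv_f(1) falling_prod_caputo_coeff flip: N_def)
        (simp add: N falling_prod_caputo_coeff)
  next
    case False
    have "((\<lambda>\<tau>. \<Sum>\<nu>\<le>n. c \<nu> * g \<nu> x \<tau>) has_integral
        (\<Sum>\<nu>\<le>n. c \<nu> * (Gamma (real N - \<mu>) * caputo_coeff \<mu> \<nu> * x powr (\<mu> * real \<nu> - \<mu>)))) {0<..<x}"
      using g(1)[OF False that] by (intro has_integral_sum has_integral_mult_right) auto
    also have "(\<Sum>\<nu>\<le>n. c \<nu> * (Gamma (real N - \<mu>) * caputo_coeff \<mu> \<nu> * x powr (\<mu> * real \<nu> - \<mu>))) =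
        Gamma (real N - \<mu>) * (\<Sum>\<nu>\<le>n. c \<nu> * caputo_coeff \<mu> \<nu> * x powr (\<mu> * real \<nu> - \<mu>))"
      by (simp add: sum_distrib_left mult_ac)
    finally have "((\<lambda>\<tau>. (deriv ^^ N) f \<tau> / (x - \<tau>) powr (\<mu> + 1 - real N)) has_integral
        Gamma (real N - \<mu>) * (\<Sum>\<nu>\<le>n. c \<nu> * caputo_coeff \<mu> \<nu> * x powr (\<mu> * real \<nu> - \<mu>))) {0<..<x}"
      by (rule has_integral_eq[rotated]) (simp add: integrand)
    moreover have "Gamma (real N - \<mu>) > 0"
    proof -
      have "\<mu> \<le> real N"
        unfolding N_def by linarith
      moreover have "\<mu> \<noteq> real N"
        using False by (metis of_nat_in_Nats)
      ultimately show ?thesis by simp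
    qed
    ultimately show ?thesis
      using False by (simp add: caputo_deriv_def Let_def integral_unique flip: N_def)
  qed
qed

section \<open>Reduction of the equation to a recurrence\<close>

text \<open>The term at 0 drops out because its multiplier is 0. The vanishing of
  \<open>c (Suc n)\<close> keeps the upper bound \<open>n\<close>, so the shift can be repeated over
  the same range.\<close>

lemma caputo_sum_shift:
  assumes "c (Suc n) = 0"
  shows "(\<Sum>\<nu>\<le>n. c \<nu> * caputo_coeff \<mu> \<nu> * x powr (\<mu> * real \<nu> - \<mu>)) =
         (\<Sum>\<nu>\<le>n. c (Suc \<nu>) * caputo_coeff \<mu> (Suc \<nu>) * x powr (\<mu> * real \<nu>))"
proof -
  have "(\<Sum>\<nu>\<le>n. c \<nu> * caputo_coeff \<mu> \<nu> * x powr (\<mu> * real \<nu> - \<mu>)) =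
        (\<Sum>\<nu>\<le>Suc n. c \<nu> * caputo_coeff \<mu> \<nu> * x powr (\<mu> * real \<nu> - \<mu>))"
    using assms by simp
  also have "\<dots> = (\<Sum>\<nu>\<le>n. c (Suc \<nu>) * caputo_coeff \<mu> (Suc \<nu>) * x powr (\<mu> * real \<nu>))"
    by (subst sum.atMost_Suc_shift) (simp add: caputo_coeff_def algebra_simps)
  finally show ?thesis .
qed

text \<open>The recurrence compares the coefficients of \<open>x powr (\<mu> * \<nu>)\<close>. At
  \<open>\<nu> = n - 1\<close> it forces \<open>c (n - 1) = 0\<close>, which is why only one parity
  survives.\<close>

lemma fractional_Hermite_solution_powr_sum:
  assumes "\<mu> > 0" "n > 0" and c_0: "\<And>\<nu>. \<nu> > n \<Longrightarrow> c \<nu> = 0"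
    and c_rec: "\<And>\<nu>. c (Suc (Suc \<nu>)) * (caputo_coeff \<mu> (Suc (Suc \<nu>)) * caputo_coeff \<mu> (Suc \<nu>)) =
                  2 * (caputo_coeff \<mu> \<nu> - caputo_coeff \<mu> n) * c \<nu>"
  shows "fractional_Hermite_solution \<mu> n (\<lambda>x. \<Sum>\<nu>\<le>n. c \<nu> * x powr (\<mu> * real \<nu>))"
proof -
  let ?h = "caputo_coeff \<mu>"
  define y where "y = (\<lambda>x::real. \<Sum>\<nu>\<le>n. c \<nu> * x powr (\<mu> * real \<nu>))"
  note D1 = caputo_powr_sum[where f = y and c = c and n = n, OF \<open>\<mu> > 0\<close>]
  have diff_y: "caputo_differentiable \<mu> y"
    by (rule D1) (simp add: y_def)
  \<comment> \<open>Two forms of the derivative are kept: in this one the factor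
    \<open>x powr \<mu>\<close> restores the exponent \<open>\<mu> * \<nu>\<close>, while the
    shifted one below has the shape required for differentiating again.\<close>
  have Dy: "caputo_deriv \<mu> y x = (\<Sum>\<nu>\<le>n. c \<nu> * ?h \<nu> * x powr (\<mu> * real \<nu> - \<mu>))" if "x > 0" for x
    by (rule D1(2)) (simp_all add: y_def that)
  have Dy_shift: "caputo_deriv \<mu> y x = (\<Sum>\<nu>\<le>n. (c (Suc \<nu>) * ?h (Suc \<nu>)) * x powr (\<mu> * real \<nu>))"
    if "x > 0" for x
    using Dy[OF that] c_0 by (simp add: caputo_sum_shift)
  note D2 = caputo_powr_sum[where f = "caputo_deriv \<mu> y", OF \<open>\<mu> > 0\<close> Dy_shift]
  have eq: "caputo_deriv \<mu> (caputo_deriv \<mu> y) x - 2 * x powr \<mu> * caputo_deriv \<mu> y x + 2 * ?h n * y x = 0"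
    if "x > 0" for x
  proof -
    have "caputo_deriv \<mu> (caputo_deriv \<mu> y) x =
        (\<Sum>\<nu>\<le>n. (c (Suc (Suc \<nu>)) * ?h (Suc (Suc \<nu>))) * ?h (Suc \<nu>) * x powr (\<mu> * real \<nu>))"
      using D2(2)[OF _ that] c_0 caputo_sum_shift[of "\<lambda>\<nu>. c (Suc \<nu>) * ?h (Suc \<nu>)" n \<mu> x] by simp
    also have "\<dots> = (\<Sum>\<nu>\<le>n. 2 * (?h \<nu> - ?h n) * c \<nu> * x powr (\<mu> * real \<nu>))"
      by (simp only: mult.assoc c_rec[simplified mult.assoc])
    finally have D2y: "caputo_deriv \<mu> (caputo_deriv \<mu> y) x = \<dots>" .
    have "x powr \<mu> * caputo_deriv \<mu> y x =
        (\<Sum>\<nu>\<le>n. c \<nu> * ?h \<nu> * (x powr \<mu> * x powr (\<mu> * real \<nu> - \<mu>)))"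
      by (simp only: Dy[OF that] sum_distrib_left mult_ac)
    also have "\<dots> = (\<Sum>\<nu>\<le>n. c \<nu> * ?h \<nu> * x powr (\<mu> * real \<nu>))"
      by (simp flip: powr_add)
    finally have "2 * x powr \<mu> * caputo_deriv \<mu> y x = (\<Sum>\<nu>\<le>n. 2 * (c \<nu> * ?h \<nu> * x powr (\<mu> * real \<nu>)))"
      by (simp add: mult.assoc flip: sum_distrib_left)
    moreover have "2 * ?h n * y x = (\<Sum>\<nu>\<le>n. 2 * ?h n * (c \<nu> * x powr (\<mu> * real \<nu>)))"
      by (simp add: y_def sum_distrib_left)
    ultimately show ?thesis
      by (simp add: D2y flip: sum_subtractf sum.distrib) (simp add: algebra_simps)
  qed
  have "2 * Gamma \<mu> / Beta (1 + \<mu> * (real n - 1)) \<mu> = 2 * ?h n"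
    using assms by (simp add: caputo_coeff_Beta)
  with eq diff_y D2(1) show ?thesis
    by (simp add: fractional_Hermite_solution_def numeral_2_eq_2 y_def)
qed

section \<open>The coefficient sequence: nonvanishing up to \<open>n\<close>, zero beyond\<close>

text \<open>The seeds \<open>\<alpha>\<close> and \<open>\<beta>\<close> start an even and an odd
  chain that never interact; setting one seed to 0 selects a parity.\<close>

fun hermite_coeff :: "real \<Rightarrow> nat \<Rightarrow> real \<Rightarrow> real \<Rightarrow> nat \<Rightarrow> real" where
  "hermite_coeff \<mu> n \<alpha> \<beta> 0 = \<alpha>"
| "hermite_coeff \<mu> n \<alpha> \<beta> (Suc 0) = \<beta>"
| "hermite_coeff \<mu> n \<alpha> \<beta> (Suc (Suc \<nu>)) =
     2 * (caputo_coeff \<mu> \<nu> - caputo_coeff \<mu> n)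
       / (caputo_coeff \<mu> (Suc (Suc \<nu>)) * caputo_coeff \<mu> (Suc \<nu>)) * hermite_coeff \<mu> n \<alpha> \<beta> \<nu>"

lemma hermite_coeff_opposite_parity:
  "hermite_coeff \<mu> n 0 \<beta> (2 * k) = 0" "hermite_coeff \<mu> n \<alpha> 0 (Suc (2 * k)) = 0"
  by (induction k) auto

lemma hermite_coeff_step_nonzero:
  assumes "\<mu> > 0" "\<nu> < n"
  shows "2 * (caputo_coeff \<mu> \<nu> - caputo_coeff \<mu> n)
           / (caputo_coeff \<mu> (Suc (Suc \<nu>)) * caputo_coeff \<mu> (Suc \<nu>)) \<noteq> 0"
  using caputo_coeff_less[OF assms] caputo_coeff_pos[OF assms(1), of "Suc \<nu>"]
    caputo_coeff_pos[OF assms(1), of "Suc (Suc \<nu>)"] by simp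

text \<open>Every step taken leaves an index below \<open>n\<close>, where strict monotonicity keeps
  the factor nonzero. The last step leaves at most \<open>n - 1\<close>, hence the bound
  \<open>Suc n\<close>.\<close>

lemma hermite_coeff_nonzero:
  assumes "\<mu> > 0"
  shows "\<alpha> \<noteq> 0 \<Longrightarrow> 2 * k \<le> Suc n \<Longrightarrow> hermite_coeff \<mu> n \<alpha> \<beta> (2 * k) \<noteq> 0"
    and "\<beta> \<noteq> 0 \<Longrightarrow> Suc (2 * k) \<le> Suc n \<Longrightarrow> hermite_coeff \<mu> n \<alpha> \<beta> (Suc (2 * k)) \<noteq> 0"
proof (induction k)
  case (Suc k)
  {
    case 1
    with Suc.IH(1) hermite_coeff_step_nonzero[OF assms, of "2 * k" n] show ?case by simp
  next
    case 2
    with Suc.IH(2) hermite_coeff_step_nonzero[OF assms, of "Suc (2 * k)" n] show ?case by simp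
  }
qed auto

text \<open>Indices of the parity of \<open>n\<close> lie on the chain cut at \<open>n\<close>; the
  others lie on the chain with seed 0.\<close>

lemma hermite_coeff_eq_0:
  assumes "\<nu> > n" "even n \<and> \<beta> = 0 \<or> odd n \<and> \<alpha> = 0"
  shows "hermite_coeff \<mu> n \<alpha> \<beta> \<nu> = 0"
proof -
  \<comment> \<open>For \<open>k = 0\<close> the step out of index \<open>n\<close> carries the
    factor \<open>caputo_coeff \<mu> n - caputo_coeff \<mu> n\<close>; later terms inherit the
    zero.\<close>
  have zero: "hermite_coeff \<mu> n \<alpha> \<beta> (n + 2 * Suc k) = 0" for k
    by (induction k) auto
  show ?thesis
  proof (cases "even \<nu> \<longleftrightarrow> even n")
    case True
    hence "even (\<nu> - n)"
      using assms(1) by simp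
    then obtain k where "\<nu> - n = 2 * k"
      by (elim evenE)
    moreover from this have "k \<noteq> 0"
      using assms(1) by auto
    ultimately have "\<nu> = n + 2 * Suc (k - 1)"
      using assms(1) by simp
    thus ?thesis
      using zero by metis
  next
    case False
    show ?thesis
    proof (cases "even \<nu>")
      case True
      thus ?thesis
        using False assms(2) by (auto elim!: evenE simp: hermite_coeff_opposite_parity)
    next
      case odd: False
      thus ?thesis
        using False assms(2) by (auto elim!: oddE simp: hermite_coeff_opposite_parity)
    qed
  qed
qed

lemma hermite_coeff_solution:
  assumes "\<mu> > 0" "n > 0" "even n \<and> \<beta> = 0 \<or> odd n \<and> \<alpha> = 0"
  shows "fractional_Hermite_solution \<mu> n (\<lambda>x. \<Sum>\<nu>\<le>n. hermite_coeff \<mu> n \<alpha> \<beta> \<nu> * x powr (\<mu> * real \<nu>))"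
proof (rule fractional_Hermite_solution_powr_sum)
  show "hermite_coeff \<mu> n \<alpha> \<beta> (Suc (Suc \<nu>)) * (caputo_coeff \<mu> (Suc (Suc \<nu>)) * caputo_coeff \<mu> (Suc \<nu>)) =
          2 * (caputo_coeff \<mu> \<nu> - caputo_coeff \<mu> n) * hermite_coeff \<mu> n \<alpha> \<beta> \<nu>" for \<nu>
    using caputo_coeff_pos[OF assms(1), of "Suc \<nu>"] caputo_coeff_pos[OF assms(1), of "Suc (Suc \<nu>)"]
    by simp
qed (use assms hermite_coeff_eq_0 in auto)

section \<open>Closed product formulas for the coefficients\<close>

text \<open>The step out of index 0 is exceptional: the multiplier there is 0 and has no Beta form,
  so only \<open>- 2 * caputo_coeff \<mu> n\<close> remains in the numerator.\<close>

lemma hermite_coeff_2: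
  assumes "\<mu> > 0" "n > 0"
  shows "hermite_coeff \<mu> n \<alpha> \<beta> 2 =
         - (2 * Gamma \<mu> / (Beta (1 + \<mu> * (real n - 1)) \<mu> * Gamma (1 + 2 * \<mu>))) * \<alpha>"
proof -
  have "hermite_coeff \<mu> n \<alpha> \<beta> 2 = - (2 * caputo_coeff \<mu> n / Gamma (1 + 2 * \<mu>)) * \<alpha>"
    using caputo_coeff_mult_Suc[OF assms(1), of 0]
    by (simp add: numeral_2_eq_2 caputo_coeff_def[of \<mu> 0])
  thus ?thesis
    using caputo_coeff_Beta[OF assms] by simp
qed

text \<open>For positive \<open>\<nu>\<close> both multipliers are \<open>Gamma \<mu>\<close> over a
  Beta value, so their difference is a difference of reciprocals; the remaining Gamma quotient is
  \<open>Beta (1 + \<nu> * \<mu>) (2 * \<mu>) / Gamma (2 * \<mu>)\<close>.\<close>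

lemma hermite_coeff_step:
  assumes "\<mu> > 0" "n > 0" "\<nu> > 0"
  shows "hermite_coeff \<mu> n \<alpha> \<beta> (Suc (Suc \<nu>)) = hermite_coeff \<mu> n \<alpha> \<beta> \<nu> *
    (2 * Gamma \<mu> * Beta (1 + real \<nu> * \<mu>) (2 * \<mu>) *
       (Beta (1 + \<mu> * (real n - 1)) \<mu> - Beta (1 + \<mu> * (real \<nu> - 1)) \<mu>) /
       (Gamma (2 * \<mu>) * Beta (1 + \<mu> * (real n - 1)) \<mu> * Beta (1 + \<mu> * (real \<nu> - 1)) \<mu>))"
proof -
  have "\<mu> * (real n - 1) \<ge> 0" "\<mu> * (real \<nu> - 1) \<ge> 0"
    using assms by auto
  hence "Beta (1 + \<mu> * (real n - 1)) \<mu> > 0" "Beta (1 + \<mu> * (real \<nu> - 1)) \<mu> > 0"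
    using assms by (auto intro!: Beta_pos_real add_pos_nonneg)
  moreover have "Gamma (2 * \<mu>) > 0" "Gamma (1 + real \<nu> * \<mu>) > 0" "Gamma (1 + (real \<nu> + 2) * \<mu>) > 0"
    using assms by (auto intro!: Gamma_real_pos add_pos_nonneg)
  moreover have "Beta (1 + real \<nu> * \<mu>) (2 * \<mu>) =
      Gamma (1 + real \<nu> * \<mu>) * Gamma (2 * \<mu>) / Gamma (1 + (real \<nu> + 2) * \<mu>)"
    by (simp add: Beta_def algebra_simps)
  ultimately show ?thesis
    by (simp only: hermite_coeff.simps caputo_coeff_mult_Suc[OF assms(1)]
        caputo_coeff_Beta[OF assms(1,2)] caputo_coeff_Beta[OF assms(1,3)])
      (simp add: divide_simps, simp add: algebra_simps)
qed

text \<open>Factor \<open>j\<close> is the step from index \<open>2 * j\<close> to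
  \<open>2 * j + 2\<close>; the exceptional step out of index 0 is the prefactor.\<close>

lemma hermite_coeff_even:
  assumes "\<mu> > 0" "n > 0"
  shows "hermite_coeff \<mu> n \<alpha> \<beta> (2 * Suc k) =
    - (2 * Gamma \<mu> * \<alpha> / (Beta (1 + \<mu> * (real n - 1)) \<mu> * Gamma (1 + 2 * \<mu>))) *
    (\<Prod>j = 1..k.
       2 * Gamma \<mu> * Beta (1 + 2 * real j * \<mu>) (2 * \<mu>) *
       (Beta (1 + \<mu> * (real n - 1)) \<mu> - Beta (1 + \<mu> * (2 * real j - 1)) \<mu>) /
       (Gamma (2 * \<mu>) * Beta (1 + \<mu> * (real n - 1)) \<mu> *
        Beta (1 + \<mu> * (2 * real j - 1)) \<mu>))"
proof (induction k)
  case 0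
  show ?case
    using hermite_coeff_2[OF assms, of \<alpha> \<beta>] by (simp flip: numeral_2_eq_2)
next
  case (Suc k)
  have "prod R {1..Suc k} = prod R {1..k} * R (Suc k)" for R :: "nat \<Rightarrow> real"
    by simp
  moreover have "2 * Suc (Suc k) = Suc (Suc (2 * Suc k))" "real (2 * Suc k) = 2 * real (Suc k)"
    "0 < 2 * Suc k"
    by simp_all
  ultimately show ?case
    using hermite_coeff_step[OF assms, of "2 * Suc k" \<alpha> \<beta>]
    by (simp only: Suc.IH mult.assoc)
qed

text \<open>Factor \<open>j\<close> is the step out of index \<open>2 * j + 1\<close>. This index is
  always positive, so there is no exceptional prefactor.\<close>

lemma hermite_coeff_odd:
  assumes "\<mu> > 0" "n > 0"
  shows "hermite_coeff \<mu> n \<alpha> \<beta> (2 * k + 1) =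
    \<beta> * (\<Prod>j<k.
       2 * Gamma \<mu> * Beta (1 + (2 * real j + 1) * \<mu>) (2 * \<mu>) *
       (Beta (1 + \<mu> * (real n - 1)) \<mu> - Beta (1 + 2 * real j * \<mu>) \<mu>) /
       (Gamma (2 * \<mu>) * Beta (1 + \<mu> * (real n - 1)) \<mu> *
        Beta (1 + 2 * real j * \<mu>) \<mu>))"
proof (induction k)
  case (Suc k)
  have "2 * Suc k + 1 = Suc (Suc (2 * k + 1))" "real (2 * k + 1) = 2 * real k + 1"
    "1 + \<mu> * (2 * real k + 1 - 1) = 1 + 2 * real k * \<mu>"
    by simp_all
  thus ?case
    using hermite_coeff_step[OF assms, of "2 * k + 1" \<alpha> \<beta>]
    by (simp only: Suc.IH prod.lessThan_Suc mult.assoc)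
qed auto

section \<open>Assembling the polynomial in both parity cases\<close>

lemma poly_of_coeffs:
  fixes a :: "nat \<Rightarrow> 'a :: comm_monoid_add"
  assumes "\<And>\<nu>. \<nu> > n \<Longrightarrow> a \<nu> = 0" "a n \<noteq> 0"
  obtains p where "degree p = n" "coeff p = a"
proof
  have fin: "\<forall>\<^sub>\<infinity>\<nu>. a \<nu> = 0"
    using assms(1) by (auto simp: MOST_nat)
  thus "coeff (Abs_poly a) = a"
    by (simp add: Abs_poly_inverse)
  thus "degree (Abs_poly a) = n"
    using assms by (intro antisym degree_le le_degree) auto
qed

theorem corollary2:
  fixes \<mu> :: real and n :: nat
  assumes "\<mu> \<in> \<rat>" and "\<mu> > 0" and "n > 0"
  shows
    "(even n \<longrightarrow>
       (\<forall>a0::real. a0 \<noteq> 0 \<longrightarrow>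
         (\<exists>p::real poly. degree p = n \<and>
            coeff p 0 = a0 \<and>
            (\<forall>k. 1 \<le> k \<and> k \<le> n div 2 \<longrightarrow> coeff p (2 * k - 1) = 0) \<and>
            coeff p 2 = - (2 * Gamma \<mu> /
                (Beta (1 + \<mu> * (real n - 1)) \<mu> * Gamma (1 + 2 * \<mu>))) * a0 \<and>
            (\<forall>k. 2 \<le> k \<and> 2 * k \<le> n \<longrightarrow>
               coeff p (2 * k) =
                 - (2 * Gamma \<mu> * a0 /
                     (Beta (1 + \<mu> * (real n - 1)) \<mu> * Gamma (1 + 2 * \<mu>))) *
                 (\<Prod>j = 1..k - 1.
                    2 * Gamma \<mu> * Beta (1 + 2 * real j * \<mu>) (2 * \<mu>) *
                    (Beta (1 + \<mu> * (real n - 1)) \<mu> - Beta (1 + \<mu> * (2 * real j - 1)) \<mu>) /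
                    (Gamma (2 * \<mu>) * Beta (1 + \<mu> * (real n - 1)) \<mu> *
                     Beta (1 + \<mu> * (2 * real j - 1)) \<mu>))) \<and>
            fractional_Hermite_solution \<mu> n
              (\<lambda>x. \<Sum>\<nu>\<le>n. coeff p \<nu> * x powr (\<mu> * real \<nu>))))) \<and>
     (odd n \<longrightarrow>
       (\<forall>a1::real. a1 \<noteq> 0 \<longrightarrow>
         (\<exists>p::real poly. degree p = n \<and>
            coeff p 1 = a1 \<and>
            (\<forall>k. k \<le> n div 2 \<longrightarrow> coeff p (2 * k) = 0) \<and>
            (\<forall>k. 1 \<le> k \<and> 2 * k + 1 \<le> n \<longrightarrow>
               coeff p (2 * k + 1) =
                 a1 *
                 (\<Prod>j = 0..k - 1.
                    2 * Gamma \<mu> * Beta (1 + (2 * real j + 1) * \<mu>) (2 * \<mu>) *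
                    (Beta (1 + \<mu> * (real n - 1)) \<mu> - Beta (1 + 2 * real j * \<mu>) \<mu>) /
                    (Gamma (2 * \<mu>) * Beta (1 + \<mu> * (real n - 1)) \<mu> *
                     Beta (1 + 2 * real j * \<mu>) \<mu>))) \<and>
            fractional_Hermite_solution \<mu> n
              (\<lambda>x. \<Sum>\<nu>\<le>n. coeff p \<nu> * x powr (\<mu> * real \<nu>)))))"
    (is "(_ \<longrightarrow> (\<forall>a0. _ \<longrightarrow> ?even a0)) \<and> (_ \<longrightarrow> (\<forall>a1. _ \<longrightarrow> ?odd a1))")
proof (intro conjI impI allI)
  fix a0 :: real
  assume n: "even n" and "a0 \<noteq> 0"
  let ?a = "hermite_coeff \<mu> n a0 0"
  \<comment> \<open>This is the leading coefficient, so the degree is exactly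
    \<open>n\<close>.\<close>
  have "?a n \<noteq> 0"
    using hermite_coeff_nonzero(1)[OF \<open>\<mu> > 0\<close> \<open>a0 \<noteq> 0\<close>, of "n div 2" n 0] n by simp
  with n obtain p where p: "degree p = n" "coeff p = ?a"
    using poly_of_coeffs[of n ?a] hermite_coeff_eq_0 by blast
  have "?a (2 * k - 1) = 0" if "1 \<le> k" for k
    using hermite_coeff_opposite_parity(2)[of \<mu> n a0 "k - 1"] that by (cases k) simp_all
  moreover have "?a (2 * k) =
      - (2 * Gamma \<mu> * a0 / (Beta (1 + \<mu> * (real n - 1)) \<mu> * Gamma (1 + 2 * \<mu>))) *
      (\<Prod>j = 1..k - 1.
         2 * Gamma \<mu> * Beta (1 + 2 * real j * \<mu>) (2 * \<mu>) *
         (Beta (1 + \<mu> * (real n - 1)) \<mu> - Beta (1 + \<mu> * (2 * real j - 1)) \<mu>) /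
         (Gamma (2 * \<mu>) * Beta (1 + \<mu> * (real n - 1)) \<mu> *
          Beta (1 + \<mu> * (2 * real j - 1)) \<mu>))" if "2 \<le> k" for k
  proof -
    have "k = Suc (k - 1)"
      using that by simp
    thus ?thesis
      using hermite_coeff_even[OF assms(2,3), of a0 0 "k - 1"] by metis
  qed
  moreover have "fractional_Hermite_solution \<mu> n (\<lambda>x. \<Sum>\<nu>\<le>n. ?a \<nu> * x powr (\<mu> * real \<nu>))"
    using n by (intro hermite_coeff_solution assms) simp
  ultimately show "?even a0"
    using p hermite_coeff_2[OF assms(2,3), of a0 0] by (intro exI[of _ p]) simp
next
  fix a1 :: real
  assume n: "odd n" and "a1 \<noteq> 0"
  let ?a = "hermite_coeff \<mu> n 0 a1"
  have "?a n \<noteq> 0"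
    using hermite_coeff_nonzero(2)[OF \<open>\<mu> > 0\<close> \<open>a1 \<noteq> 0\<close>, of "n div 2" n 0] n by simp
  with n obtain p where p: "degree p = n" "coeff p = ?a"
    using poly_of_coeffs[of n ?a] hermite_coeff_eq_0 by blast
  have "?a (2 * k + 1) =
      a1 * (\<Prod>j = 0..k - 1.
         2 * Gamma \<mu> * Beta (1 + (2 * real j + 1) * \<mu>) (2 * \<mu>) *
         (Beta (1 + \<mu> * (real n - 1)) \<mu> - Beta (1 + 2 * real j * \<mu>) \<mu>) /
         (Gamma (2 * \<mu>) * Beta (1 + \<mu> * (real n - 1)) \<mu> *
          Beta (1 + 2 * real j * \<mu>) \<mu>))" if "1 \<le> k" for k
  proof -
    \<comment> \<open>Truncated subtraction makes this false at \<open>k = 0\<close>, where the left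
      side would still contain 0.\<close>
    have "{0..k - 1} = {..<k}"
      using that by auto
    thus ?thesis
      using hermite_coeff_odd[OF assms(2,3), of 0 a1 k] by (simp only:)
  qed
  moreover have "fractional_Hermite_solution \<mu> n (\<lambda>x. \<Sum>\<nu>\<le>n. ?a \<nu> * x powr (\<mu> * real \<nu>))"
    using n by (intro hermite_coeff_solution assms) simp
  ultimately show "?odd a1"
    using p hermite_coeff_opposite_parity(1)[of \<mu> n a1] by (intro exI[of _ p]) simp
qed

end
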